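(* There exists a measure preserving system $(X,\mathcal{X},\mu,T_1,T_2)$ with commuting transformations $T_1$ and $T_2$ (i.e. $T_1T_2=T_2T_1$), ergodic for $\langle T_1,T_2\rangle$, such that for every real number $\ell$ with $0<\ell<4$ there exists a set $A\in\mathcal{X}$ such that $$\mu(A\cap T_1^{-n}A\cap T_2^{-n}A)<\mu(A)^{\ell}\quad\text{for every integer } n\neq 0.$$
   Context: A measure preserving system is a tuple $(X,\mathcal{X},\mu,T_1,\ldots,T_d)$, where $(X,\mathcal{X},\mu)$ is a probability space and $T_1,\ldots,T_d\colon X\to X$ are (invertible, bimeasurable) maps such that for all $A\in\mathcal{X}$ and $1\le i\le d$, $T_i^{-1}A\in\mathcal{X}$ and $\mu(T_i^{-1}A)=\mu(A)$. $\langle T_1,\ldots,T_d\rangle$ denotes the group generated by $T_1,\ldots,T_d$. The system is ergodic for $\langle T_1,\ldots,T_d\rangle$ if, whenever $A\in\mathcal{X}$ satisfies $T_i^{-1}A=A$ for all $1\le i\le d$, one has $\mu(A)=0$ or $1$. The single system works for all $\ell$; the set $A$ may depend on $\ell$ but not on $n$. *)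

theory Defs
  imports "HOL-Probability.Probability"
begin

text \<open>
  The maps are total functions on the ambient type, but only their behaviour on \<^term>\<open>space M\<close>
  matters; so inverses are taken relative to \<^term>\<open>space M\<close> and preimages are intersected with it.
\<close>

locale measure_preserving_system = prob_space M for M :: "'a measure" +
  fixes Ts :: "('a \<Rightarrow> 'a) list"
  assumes invertible: "T \<in> set Ts \<Longrightarrow> bij_betw T (space M) (space M)"
    and measurable_map: "T \<in> set Ts \<Longrightarrow> T \<in> M \<rightarrow>\<^sub>M M"
    and measurable_inverse: "T \<in> set Ts \<Longrightarrow> inv_into (space M) T \<in> M \<rightarrow>\<^sub>M M"
    and measure_preserving:
      "\<lbrakk>T \<in> set Ts; A \<in> sets M\<rbrakk> \<Longrightarrow> measure M (T -` A \<inter> space M) = measure M A"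

text \<open>Strictly invariant sets under the generators are the same as under the generated group.\<close>

locale ergodic_system = measure_preserving_system +
  assumes ergodic:
    "\<lbrakk>A \<in> sets M; \<And>T. T \<in> set Ts \<Longrightarrow> T -` A \<inter> space M = A\<rbrakk>
      \<Longrightarrow> measure M A = 0 \<or> measure M A = 1"

definition int_iterate :: "'a measure \<Rightarrow> ('a \<Rightarrow> 'a) \<Rightarrow> int \<Rightarrow> 'a \<Rightarrow> 'a" where
  "int_iterate M T n =
    (if n \<ge> 0 then T ^^ nat n else inv_into (space M) T ^^ nat (- n))"

text \<open>The set \<open>T\<^sup>-\<^sup>n A\<close>, that is, the preimage of \<open>A\<close> under \<open>T\<^sup>n\<close>.\<close>

definition preimage_iterate :: "'a measure \<Rightarrow> ('a \<Rightarrow> 'a) \<Rightarrow> int \<Rightarrow> 'a set \<Rightarrow> 'a set" where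
  "preimage_iterate M T n A = int_iterate M T n -` A \<inter> space M"

end

theory Submission
  imports Defs
begin

text \<open>
  Let \<open>\<omega>\<^sub>0, \<omega>\<^sub>1, \<omega>\<^sub>2\<close> be three independent two-sided sequences of independent uniform random reals, let
  \<open>T\<^sub>1\<close> shift \<open>\<omega>\<^sub>0\<close> and \<open>\<omega>\<^sub>2\<close> by one step and let \<open>T\<^sub>2\<close> shift \<open>\<omega>\<^sub>1\<close> and \<open>\<omega>\<^sub>2\<close>. These maps commute, and
  \<open>T\<^sub>1 T\<^sub>2\<close> shifts every sequence, so it is mixing like any Bernoulli shift; in particular the system
  is ergodic. Consider an event \<open>A\<close> saying that the triple \<open>(\<omega>\<^sub>0 0, \<omega>\<^sub>1 0, \<omega>\<^sub>2 0)\<close> lies in a set \<open>H\<close>. For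
  \<open>n \<noteq> 0\<close> the event \<open>A \<inter> T\<^sub>1\<^sup>-\<^sup>n A \<inter> T\<^sub>2\<^sup>-\<^sup>n A\<close> then says that the three triples
  \<open>(\<omega>\<^sub>0 0, \<omega>\<^sub>1 0, \<omega>\<^sub>2 0)\<close>, \<open>(\<omega>\<^sub>0 n, \<omega>\<^sub>1 0, \<omega>\<^sub>2 n)\<close>, \<open>(\<omega>\<^sub>0 0, \<omega>\<^sub>1 n, \<omega>\<^sub>2 n)\<close> all lie in \<open>H\<close>. Only six independent
  coordinates are involved, and any two of the triples share exactly one of them.

  Now replace each real number by one of \<open>N\<close> equally likely labels, and let \<open>H\<close> come from a set \<open>P\<close> of
  label triples with the property of Ruzsa and Szemeredi: three triples of \<open>P\<close> which pairwise share a
  label, in the three different places, coincide. Then the joint event forces the three triples to be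
  one and the same element of \<open>P\<close>, so its probability is at most \<open>|P| / N\<^sup>6\<close>, while \<open>A\<close> has probability
  \<open>|P| / N\<^sup>3\<close>. If \<open>|P| = N\<^bsup>2 - o(1)\<^esup>\<close>, these are \<open>N\<^bsup>-4 - o(1)\<^esup>\<close> and \<open>N\<^bsup>-1 - o(1)\<^esup>\<close>, which gives every exponent below 4.

  Such sets \<open>P\<close> come from Behrend's idea. The labels are the vectors in \<open>{0..<2m}\<^sup>d\<close>, and \<open>P\<close> consists of
  the triples \<open>(x, y, x + y)\<close> with \<open>x, y \<in> {0..<m}\<^sup>d\<close> and \<open>|x - y|\<^sup>2 = R\<close>. If \<open>(a, b, _)\<close>, \<open>(_, b, c)\<close> and
  \<open>(a, _, c)\<close> extend to elements of \<open>P\<close>, then \<open>u = 2a - c\<close>, \<open>v = c - 2b\<close> and their midpoint \<open>a - b\<close> lie on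
  one sphere, whence \<open>u = v\<close> and \<open>c = a + b\<close> (lemma \<open>sphere_triangle\<close>). By the pigeonhole principle
  some \<open>R\<close> gives \<open>|P| \<ge> m\<^bsup>2d\<^esup> / (2 d m\<^sup>2)\<close>, and it remains to choose first \<open>d\<close> and then \<open>m\<close> large.
\<close>

section \<open>Label triples without nondegenerate triangles\<close>

text \<open>
  The sum of the two vectors \<open>2 a - c\<close> and \<open>c - 2 b\<close> is \<open>2 (a - b)\<close>, so all three have prescribed norms and the
  parallelogram law leaves norm 0 for their difference \<open>2 (a + b - c)\<close>: a sphere contains no midpoint
  of two different points of it.
\<close>
lemma sphere_triangle:
  fixes a b c :: "'i \<Rightarrow> int"
  assumes "finite I"
    and "(\<Sum>i\<in>I. (a i - b i)\<^sup>2) = R"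
    and "(\<Sum>i\<in>I. ((c i - b i) - b i)\<^sup>2) = R"
    and "(\<Sum>i\<in>I. (a i - (c i - a i))\<^sup>2) = R"
    and "i \<in> I"
  shows "c i = a i + b i"
proof -
  let ?u = "\<lambda>i. a i - (c i - a i)" and ?v = "\<lambda>i. (c i - b i) - b i"
  have "(\<Sum>i\<in>I. (?u i + ?v i)\<^sup>2) = (\<Sum>i\<in>I. 4 * (a i - b i)\<^sup>2)"
    by (intro sum.cong) (auto simp: power2_eq_square algebra_simps)
  then have s: "(\<Sum>i\<in>I. (?u i + ?v i)\<^sup>2) = 4 * R"
    using assms(2) by (simp only: sum_distrib_left[symmetric])
  have "(\<Sum>i\<in>I. (?u i - ?v i)\<^sup>2)
      = 2 * (\<Sum>i\<in>I. (?u i)\<^sup>2) + 2 * (\<Sum>i\<in>I. (?v i)\<^sup>2) - (\<Sum>i\<in>I. (?u i + ?v i)\<^sup>2)"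
    unfolding sum_distrib_left sum.distrib[symmetric] sum_subtractf[symmetric]
    by (intro sum.cong) (auto simp: power2_eq_square algebra_simps)
  then have "(\<Sum>i\<in>I. (?u i - ?v i)\<^sup>2) = 0"
    unfolding s assms(3,4) by simp
  then have "?u i - ?v i = 0"
    using assms(1,5) by (simp add: sum_nonneg_eq_0_iff)
  moreover have "?u i - ?v i = 2 * (a i + b i - c i)" by simp
  ultimately show ?thesis by simp
qed

text \<open>
  The \<open>\<alpha>\<close>-, \<open>\<beta>\<close>- and \<open>\<gamma>\<close>-labels of a pair \<open>(x, y)\<close> encode \<open>x\<close>, \<open>y\<close> and \<open>x + y\<close>. Pairs are sorted by their squared
  distance, which takes at most \<open>d m\<^sup>2 + 1 \<le> 2 d m\<^sup>2\<close> values, and \<open>P\<close> is a class of at least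
  average size.
\<close>
lemma triangle_system_exists:
  assumes m: "m \<ge> 1" and d: "d \<ge> 1"
  obtains P :: "((nat \<Rightarrow> int) \<times> (nat \<Rightarrow> int)) set" and \<alpha> \<beta> \<gamma> :: "_ \<Rightarrow> nat"
  where "finite P" "card P \<le> m ^ (2 * d)" "m ^ (2 * d) \<le> card P * (2 * d * m\<^sup>2)"
    "\<And>p. p \<in> P \<Longrightarrow> \<alpha> p < (2 * m) ^ d \<and> \<beta> p < (2 * m) ^ d \<and> \<gamma> p < (2 * m) ^ d"
    "\<And>p q r. \<lbrakk>p \<in> P; q \<in> P; r \<in> P; \<beta> p = \<beta> q; \<alpha> p = \<alpha> r; \<gamma> q = \<gamma> r\<rbrakk> \<Longrightarrow> q = p \<and> r = p"
proof -
  define Q :: "(nat \<Rightarrow> int) set" where "Q = PiE {..<d} (\<lambda>_. {0..<int m})"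
  define V :: "(nat \<Rightarrow> int) set" where "V = PiE {..<d} (\<lambda>_. {0..<2 * int m})"
  have finQ: "finite Q" and finV: "finite V"
    by (auto simp: Q_def V_def intro!: finite_PiE)
  have cardQ: "card Q = m ^ d" and cardV: "card V = (2 * m) ^ d"
    by (auto simp: Q_def V_def card_PiE nat_mult_distrib)
  obtain h where h: "bij_betw h V {0..<(2 * m) ^ d}"
    using ex_bij_betw_finite_nat[OF finV] cardV by auto
  have h_less: "h x < (2 * m) ^ d" if "x \<in> V" for x
    using bij_betwE[OF h] that by auto
  have h_inj: "x = y" if "h x = h y" "x \<in> V" "y \<in> V" for x y
    using bij_betw_imp_inj_on[OF h] that by (auto dest: inj_onD)
  define sqdist where "sqdist = (\<lambda>(x :: nat \<Rightarrow> int, y). nat (\<Sum>i<d. (x i - y i)\<^sup>2))"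
  have sqdist: "sqdist \<in> Q \<times> Q \<rightarrow> {..d * m\<^sup>2}"
  proof
    fix p assume "p \<in> Q \<times> Q"
    then obtain x y where p: "p = (x, y)" "x \<in> Q" "y \<in> Q" by auto
    have "(x i - y i)\<^sup>2 \<le> (int m)\<^sup>2" if "i < d" for i
    proof -
      have "x i \<in> {0..<int m}" "y i \<in> {0..<int m}" using p that by (auto simp: Q_def PiE_iff)
      then show ?thesis by (intro abs_le_square_iff[THEN iffD1]) auto
    qed
    then have "(\<Sum>i<d. (x i - y i)\<^sup>2) \<le> (\<Sum>i<d. (int m)\<^sup>2)" by (intro sum_mono) auto
    then show "sqdist p \<in> {..d * m\<^sup>2}" by (simp add: sqdist_def p nat_le_iff)
  qed
  obtain R where R: "card (Q \<times> Q) \<le> card (sqdist -` {R} \<inter> Q \<times> Q) * card {..d * m\<^sup>2}"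
    using pigeonhole_card[OF sqdist] finQ by auto
  define P where "P = sqdist -` {R} \<inter> Q \<times> Q"
  define \<gamma> where "\<gamma> = (\<lambda>(x :: nat \<Rightarrow> int, y). h (\<lambda>i\<in>{..<d}. x i + y i))"
  have "Q \<subseteq> V" unfolding Q_def V_def by (rule PiE_mono) auto
  then have QV: "x \<in> V" if "x \<in> Q" for x using that by auto
  have sumV: "(\<lambda>i\<in>{..<d}. x i + y i) \<in> V" if "x \<in> Q" "y \<in> Q" for x y
    unfolding V_def
  proof (rule restrict_PiE_iff[THEN iffD2], rule ballI)
    fix i assume i: "i \<in> {..<d}"
    have "x i \<in> {0..<int m}" "y i \<in> {0..<int m}"
      using PiE_mem[OF that(1)[unfolded Q_def] i] PiE_mem[OF that(2)[unfolded Q_def] i] by auto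
    then show "x i + y i \<in> {0..<2 * int m}" by simp
  qed
  show thesis
  proof (rule that[of P "\<lambda>p. h (fst p)" "\<lambda>p. h (snd p)" \<gamma>])
    show "finite P" using finQ by (auto simp: P_def)
    have "card P \<le> card (Q \<times> Q)" unfolding P_def using finQ by (intro card_mono) auto
    also have QQ: "card (Q \<times> Q) = m ^ (2 * d)"
      by (simp add: card_cartesian_product cardQ power_add[symmetric] mult_2)
    finally show "card P \<le> m ^ (2 * d)" .
    have "1 \<le> d * m\<^sup>2" using m d by simp
    then have "card {..d * m\<^sup>2} \<le> 2 * d * m\<^sup>2" by simp
    with R show "m ^ (2 * d) \<le> card P * (2 * d * m\<^sup>2)"
      unfolding QQ P_def[symmetric] by (meson le_trans mult_le_mono2)
    show "h (fst p) < (2 * m) ^ d \<and> h (snd p) < (2 * m) ^ d \<and> \<gamma> p < (2 * m) ^ d" if p: "p \<in> P" for p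
    proof -
      obtain x y where "p = (x, y)" "x \<in> Q" "y \<in> Q" using p by (auto simp: P_def)
      then show ?thesis
        unfolding \<gamma>_def by (simp only: fst_conv snd_conv prod.case) (intro conjI h_less QV sumV)
    qed
    fix p q r assume pqr: "p \<in> P" "q \<in> P" "r \<in> P"
      and eq: "h (snd p) = h (snd q)" "h (fst p) = h (fst r)" "\<gamma> q = \<gamma> r"
    obtain a b where p: "p = (a, b)" "a \<in> Q" "b \<in> Q" using pqr by (auto simp: P_def)
    obtain a' b\<^sub>1 where q': "q = (a', b\<^sub>1)" "a' \<in> Q" "b\<^sub>1 \<in> Q" using pqr by (auto simp: P_def)
    obtain a\<^sub>1 b' where r': "r = (a\<^sub>1, b')" "a\<^sub>1 \<in> Q" "b' \<in> Q" using pqr by (auto simp: P_def)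
    have "b\<^sub>1 = b" using h_inj[OF _ QV QV, of b b\<^sub>1] eq(1) p q' by simp
    with q' have q: "q = (a', b)" "a' \<in> Q" by auto
    have "a\<^sub>1 = a" using h_inj[OF _ QV QV, of a a\<^sub>1] eq(2) p r' by simp
    with r' have r: "r = (a, b')" "b' \<in> Q" by auto
    have sum_eq: "(\<lambda>i\<in>{..<d}. a' i + b i) = (\<lambda>i\<in>{..<d}. a i + b' i)"
      using eq(3) unfolding q(1) r(1) \<gamma>_def prod.case by (rule h_inj) (intro sumV p q r)+
    have c: "a' i + b i = a i + b' i" if "i < d" for i
      using fun_cong[OF sum_eq, of i] that by simp
    have D: "(\<Sum>i<d. (x i - y i)\<^sup>2) = int R" if "(x, y) \<in> P" for x y
      using that by (auto simp: P_def sqdist_def sum_nonneg)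
    have "a' i + b i = a i + b i" if "i < d" for i
    proof (rule sphere_triangle[of "{..<d}" a b "int R" "\<lambda>i. a' i + b i"])
      show "(\<Sum>i<d. (a i - b i)\<^sup>2) = int R" using D pqr p by auto
      show "(\<Sum>i<d. (a' i + b i - b i - b i)\<^sup>2) = int R" using D pqr q by auto
      have "(\<Sum>i<d. (a i - (a' i + b i - a i))\<^sup>2) = (\<Sum>i<d. (a i - b' i)\<^sup>2)"
        using c by (intro sum.cong) auto
      then show "(\<Sum>i<d. (a i - (a' i + b i - a i))\<^sup>2) = int R" using D pqr r by auto
    qed (use that in auto)
    then have e: "a' i = a i" "b' i = b i" if "i < d" for i using c[of i] that by simp_all
    have "a' = a" by (rule PiE_ext[of _ "{..<d}" "\<lambda>_. {0..<int m}"]) (use p q e in \<open>auto simp: Q_def\<close>)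
    moreover have "b' = b" by (rule PiE_ext[of _ "{..<d}" "\<lambda>_. {0..<int m}"]) (use p r e in \<open>auto simp: Q_def\<close>)
    ultimately show "q = p \<and> r = p" using p q r by simp
  qed
qed

text \<open>
  Up to constants depending on \<open>d\<close>, the left side is at most \<open>m\<^bsup>-4d\<^esup>\<close> and the right side at least
  \<open>m\<^bsup>-(d + 2) l\<^esup>\<close>. For \<open>l < 4\<close> the second exponent is the larger one once \<open>d\<close> is large, and then a large \<open>m\<close>
  beats the constants.
\<close>
lemma triangle_system_parameters:
  fixes l :: real
  assumes l: "0 < l" "l < 4"
  obtains m d :: nat where "m \<ge> 1" "d \<ge> 1"
    "\<And>c. \<lbrakk>c \<le> m ^ (2 * d); m ^ (2 * d) \<le> c * (2 * d * m\<^sup>2)\<rbrakk>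
      \<Longrightarrow> real c / real ((2 * m) ^ d) ^ 6 < (real c / real ((2 * m) ^ d) ^ 3) powr l"
proof -
  obtain d where d: "2 * l / (4 - l) < real d" using reals_Archimedean2 by blast
  then have e: "0 < 4 * real d - (real d + 2) * l" using l by (simp add: field_simps)
  have "0 \<le> 2 * l / (4 - l)" using l by simp
  with d have "0 < real d" by linarith
  then have d1: "d \<ge> 1" by simp
  define e where "e = 4 * real d - (real d + 2) * l"
  define C where "C = 2 * real d * 8 ^ d"
  have C: "0 < C" using d1 by (simp add: C_def)
  have "filterlim (\<lambda>m. real m powr e) at_top sequentially"
    by (rule filterlim_compose[OF real_powr_at_top filterlim_real_sequentially]) (use e in \<open>simp add: e_def\<close>)
  then have "eventually (\<lambda>m. C powr l < real m powr e) sequentially"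
    by (simp add: filterlim_at_top_dense)
  then have "eventually (\<lambda>m. C powr l < real m powr e \<and> m \<ge> 1) sequentially"
    by (intro eventually_conj eventually_ge_at_top)
  then obtain m where m: "C powr l < real m powr e" "m \<ge> 1"
    using eventually_happens'[OF sequentially_bot] by blast
  define M where "M = real m"
  have M: "M > 0" using m by (simp add: M_def)
  have main: "real c / real ((2 * m) ^ d) ^ 6 < (real c / real ((2 * m) ^ d) ^ 3) powr l"
    if c: "c \<le> m ^ (2 * d)" "m ^ (2 * d) \<le> c * (2 * d * m\<^sup>2)" for c
  proof -
    have N: "real ((2 * m) ^ d) = 2 ^ d * M ^ d" by (simp add: M_def power_mult_distrib)
    have "real c \<le> real (m ^ (2 * d))" using c(1) by (simp only: of_nat_le_iff)
    then have c1: "real c \<le> M ^ (2 * d)" by (simp add: M_def)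
    have "real (m ^ (2 * d)) \<le> real (c * (2 * d * m\<^sup>2))" using c(2) by (simp only: of_nat_le_iff)
    then have c2: "M ^ (2 * d) \<le> real c * (2 * real d * M\<^sup>2)" by (simp add: M_def)
    have density: "M powr (- (real d + 2)) / C \<le> real c / (2 ^ d * M ^ d) ^ 3"
    proof -
      have sq: "M ^ (2 * d) = (M ^ d)\<^sup>2"
        by (simp add: mult.commute flip: power_mult)
      have cube: "8 ^ d = ((2::real) ^ d) ^ 3"
        using power_mult[of "2::real" 3 d] power_mult[of "2::real" d 3] by (simp add: mult.commute)
      have "M powr (- (real d + 2)) = 1 / M ^ (d + 2)"
        using powr_realpow[OF M, of "d + 2"] powr_minus_divide[of M "real d + 2"]
        by (simp add: add.commute)
      also have "\<dots> = 1 / (M ^ d * M\<^sup>2)" by (simp only: power_add)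
      also have "\<dots> = M ^ (2 * d) / (M\<^sup>2 * (M ^ d) ^ 3)"
        unfolding sq using M by (simp add: power2_eq_square power3_eq_cube)
      finally have "M powr (- (real d + 2)) / C = M ^ (2 * d) / (2 * real d * M\<^sup>2) / (2 ^ d * M ^ d) ^ 3"
        unfolding C_def cube power_mult_distrib by simp
      also have "\<dots> \<le> real c / (2 ^ d * M ^ d) ^ 3"
        using c2 M d1 by (intro divide_right_mono) (auto simp: divide_le_eq)
      finally show ?thesis .
    qed
    have "real c / (2 ^ d * M ^ d) ^ 6 \<le> M ^ (2 * d) / (M ^ d) ^ 6"
      using c1 M by (intro frac_le power_mono) auto
    also have "\<dots> = M powr (- 4 * real d)"
      using M by (simp add: powr_realpow[symmetric] powr_mult powr_powr powr_diff[symmetric] flip: power_mult)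
    also have "\<dots> = M powr (- (real d + 2) * l) / M powr e"
      using M by (simp add: e_def powr_diff[symmetric] algebra_simps)
    also have "\<dots> < M powr (- (real d + 2) * l) / C powr l"
      using m C M by (intro divide_strict_left_mono) (auto simp: M_def)
    also have "\<dots> = (M powr (- (real d + 2)) / C) powr l"
      using C M by (simp add: powr_divide powr_powr)
    also have "\<dots> \<le> (real c / (2 ^ d * M ^ d) ^ 3) powr l"
      using l C M by (intro powr_mono2 density) auto
    finally show ?thesis unfolding N .
  qed
  show thesis using that[OF m(2) d1 main] by blast
qed

section \<open>Mixing of index permutations of a product measure\<close>

text \<open>
  For a fixed set on one side, the sets on the other side for which the limit is right form a Dynkin
  system: complements are immediate, and for disjoint unions Tannery's theorem allows the limit to be
  taken term by term, since the \<open>k\<close>-th term is bounded by the measure of the \<open>k\<close>-th set uniformly in \<open>n\<close>.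
  The argument is run first for \<open>B\<close>, with \<open>A\<close> in the generator, and then for \<open>A\<close>, with \<open>B\<close> arbitrary.
\<close>
lemma (in prob_space) mixing_of_generator:
  fixes f :: "nat \<Rightarrow> 'a \<Rightarrow> 'a"
  assumes gen: "sets M = sigma_sets (space M) G" "G \<subseteq> Pow (space M)" "Int_stable G"
    and meas: "\<And>n. f n \<in> M \<rightarrow>\<^sub>M M"
    and preserving: "\<And>n A. A \<in> sets M \<Longrightarrow> prob (f n -` A \<inter> space M) = prob A"
    and mixing: "\<And>A B. A \<in> G \<Longrightarrow> B \<in> G \<Longrightarrow>
      (\<lambda>n. prob (A \<inter> (f n -` B \<inter> space M))) \<longlonglongrightarrow> prob A * prob B"
    and A: "A \<in> sets M" and B: "B \<in> sets M"
  shows "(\<lambda>n. prob (A \<inter> (f n -` B \<inter> space M))) \<longlonglongrightarrow> prob A * prob B"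
proof -
  have pre [measurable]: "f n -` B \<inter> space M \<in> sets M" if "B \<in> sets M" for n B
    using meas that by (rule measurable_sets)
  have G_sets: "B \<in> sets M" if "B \<in> G" for B
    unfolding gen(1) using that by (rule sigma_sets.Basic)
  have right: "(\<lambda>n. prob (A \<inter> (f n -` B \<inter> space M))) \<longlonglongrightarrow> prob A * prob B"
    if A: "A \<in> G" and B: "B \<in> sets M" for A B
    using gen(3) gen(2) B[unfolded gen(1)]
  proof (induction rule: sigma_sets_induct_disjoint)
    case (basic B)
    show ?case using A basic by (rule mixing)
  next
    case empty
    show ?case by simp
  next
    case (compl B)
    have B: "B \<in> sets M" using compl(1) by (simp add: gen(1))
    have "A \<subseteq> space M" using gen(2) A by auto
    then have "A \<inter> (f n -` (space M - B) \<inter> space M) = A - (A \<inter> (f n -` B \<inter> space M))" for n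
      using measurable_space[OF meas] by auto
    then have "prob (A \<inter> (f n -` (space M - B) \<inter> space M))
        = prob A - prob (A \<inter> (f n -` B \<inter> space M))" for n
      using pre[OF B] G_sets[OF A] by (simp add: finite_measure_Diff)
    moreover have "prob A * prob (space M - B) = prob A - prob A * prob B"
      using B by (simp add: prob_compl algebra_simps)
    ultimately show ?case by (simp add: compl.IH tendsto_diff)
  next
    case (union D)
    have D: "D k \<in> sets M" for k using union(2) by (auto simp: gen(1))
    have sums: "(\<lambda>k. prob (D k)) sums prob (\<Union>k. D k)"
      by (rule finite_measure_UNION) (use D union(1) in auto)
    have "(\<lambda>k. prob (A \<inter> (f n -` D k \<inter> space M))) sums
        prob (\<Union>k. A \<inter> (f n -` D k \<inter> space M))" for n
      by (rule finite_measure_UNION)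
        (use D union(1) G_sets[OF A] pre in \<open>auto simp: disjoint_family_on_def\<close>)
    moreover have "(\<Union>k. A \<inter> (f n -` D k \<inter> space M)) = A \<inter> (f n -` (\<Union>k. D k) \<inter> space M)" for n
      by auto
    ultimately have eq: "prob (A \<inter> (f n -` (\<Union>k. D k) \<inter> space M)) =
        (\<Sum>k. prob (A \<inter> (f n -` D k \<inter> space M)))" for n
      by (simp add: sums_iff)
    have "prob (A \<inter> (f n -` D k \<inter> space M)) \<le> prob (f n -` D k \<inter> space M)" for n k
      by (intro finite_measure_mono pre D) auto
    then have "prob (A \<inter> (f n -` D k \<inter> space M)) \<le> prob (D k)" for n k
      by (simp add: preserving[OF D])
    then have "(\<lambda>n. \<Sum>k. prob (A \<inter> (f n -` D k \<inter> space M)))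
        \<longlonglongrightarrow> (\<Sum>k. prob A * prob (D k))"
      by (intro tannerys_theorem[where M = "\<lambda>k. prob (D k)", THEN conjunct2, THEN conjunct2] union.IH sums_summable[OF sums])
        (auto intro!: always_eventually)
    moreover have "(\<Sum>k. prob A * prob (D k)) = prob A * prob (\<Union>k. D k)"
      using sums_mult[OF sums] by (simp add: sums_iff)
    ultimately show ?case by (simp add: eq)
  qed
  show ?thesis using gen(3) gen(2) A[unfolded gen(1)]
  proof (induction rule: sigma_sets_induct_disjoint)
    case (basic A)
    then show ?case using B by (rule right)
  next
    case empty
    show ?case by simp
  next
    case (compl A)
    have A: "A \<in> sets M" using compl(1) by (simp add: gen(1))
    have "(space M - A) \<inter> (f n -` B \<inter> space M)
        = (f n -` B \<inter> space M) - (A \<inter> (f n -` B \<inter> space M))" for n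
      by auto
    then have "prob ((space M - A) \<inter> (f n -` B \<inter> space M))
        = prob B - prob (A \<inter> (f n -` B \<inter> space M))" for n
      using finite_measure_Diff[OF pre[OF B] sets.Int[OF A pre[OF B]], of n n]
      by (auto simp: preserving[OF B])
    moreover have "prob (space M - A) * prob B = prob B - prob A * prob B"
      using A by (simp add: prob_compl algebra_simps)
    ultimately show ?case by (simp add: compl.IH tendsto_diff)
  next
    case (union D)
    have D: "D k \<in> sets M" for k using union(2) by (auto simp: gen(1))
    have sums: "(\<lambda>k. prob (D k)) sums prob (\<Union>k. D k)"
      by (rule finite_measure_UNION) (use D union(1) in auto)
    have "(\<lambda>k. prob (D k \<inter> (f n -` B \<inter> space M))) sums
        prob (\<Union>k. D k \<inter> (f n -` B \<inter> space M))" for n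
      by (rule finite_measure_UNION)
        (use D union(1) pre[OF B] in \<open>auto simp: disjoint_family_on_def\<close>)
    moreover have "(\<Union>k. D k \<inter> (f n -` B \<inter> space M)) = (\<Union>k. D k) \<inter> (f n -` B \<inter> space M)" for n
      by auto
    ultimately have eq: "prob ((\<Union>k. D k) \<inter> (f n -` B \<inter> space M)) =
        (\<Sum>k. prob (D k \<inter> (f n -` B \<inter> space M)))" for n
      by (simp add: sums_iff)
    have "prob (D k \<inter> (f n -` B \<inter> space M)) \<le> prob (D k)" for n k
      using D by (intro finite_measure_mono) auto
    then have "(\<lambda>n. \<Sum>k. prob (D k \<inter> (f n -` B \<inter> space M)))
        \<longlonglongrightarrow> (\<Sum>k. prob (D k) * prob B)"
      by (intro tannerys_theorem[where M = "\<lambda>k. prob (D k)", THEN conjunct2, THEN conjunct2] union.IH sums_summable[OF sums])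
        (auto intro!: always_eventually)
    moreover have "(\<Sum>k. prob (D k) * prob B) = prob (\<Union>k. D k) * prob B"
      using sums_mult2[OF sums] by (simp add: sums_iff)
    ultimately show ?case by (simp add: eq)
  qed
qed

definition unit_interval :: "real measure" where
  "unit_interval = uniform_measure lborel {0..<1}"

definition noise :: "(nat \<Rightarrow> real) measure" where
  "noise = (\<Pi>\<^sub>M k\<in>UNIV. unit_interval)"

lemma space_unit_interval [simp]: "space unit_interval = UNIV"
  and sets_unit_interval [simp]: "sets unit_interval = sets borel"
  by (auto simp: unit_interval_def)

lemma prob_space_unit_interval: "prob_space unit_interval"
  unfolding unit_interval_def by (rule prob_space_uniform_measure) auto

lemma space_noise [simp]: "space noise = UNIV"
  by (auto simp: noise_def space_PiM)

interpretation coords: product_prob_space "\<lambda>_. unit_interval" "UNIV :: nat set"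
  by (intro product_prob_spaceI prob_space_unit_interval)

interpretation noise: prob_space noise
  unfolding noise_def by (intro prob_space_PiM prob_space_unit_interval)

definition cylinder :: "nat set \<Rightarrow> (nat \<Rightarrow> real set) \<Rightarrow> (nat \<Rightarrow> real) set" where
  "cylinder J X = {\<omega>. \<forall>j\<in>J. \<omega> j \<in> X j}"

lemma cylinder_sets [measurable, intro]:
  assumes "finite J" "\<And>j. j \<in> J \<Longrightarrow> X j \<in> sets borel"
  shows "cylinder J X \<in> sets noise"
proof -
  have "cylinder J X = prod_emb UNIV (\<lambda>_. unit_interval) J (Pi\<^sub>E J X)"
    by (auto simp: cylinder_def prod_emb_def PiE_def Pi_def extensional_def)
  then show ?thesis unfolding noise_def using assms by (auto intro!: sets_PiM_I)
qed

lemma measure_cylinder: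
  assumes "finite J" "\<And>j. j \<in> J \<Longrightarrow> X j \<in> sets borel"
  shows "measure noise (cylinder J X) = (\<Prod>j\<in>J. measure unit_interval (X j))"
proof -
  have "cylinder J X = prod_emb UNIV (\<lambda>_. unit_interval) J (Pi\<^sub>E J X)"
    by (auto simp: cylinder_def prod_emb_def PiE_def Pi_def extensional_def)
  then show ?thesis using coords.measure_PiM_emb[of J X] assms by (simp add: noise_def)
qed

lemma cylinder_generator:
  "sets noise = sigma_sets (space noise) (prod_algebra UNIV (\<lambda>_. unit_interval))"
  "prod_algebra UNIV (\<lambda>_. unit_interval) \<subseteq> Pow (space noise)"
  unfolding noise_def using prod_algebra_sets_into_space[of UNIV "\<lambda>_. unit_interval"]
  by (auto simp: sets_PiM space_PiM)

lemma generator_is_cylinder: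
  assumes "C \<in> prod_algebra UNIV (\<lambda>_. unit_interval)"
  obtains J X where "C = cylinder J X" "finite J" "\<And>j. j \<in> J \<Longrightarrow> X j \<in> sets borel"
  using assms
proof (rule prod_algebraE)
  fix J and X :: "nat \<Rightarrow> real set"
  assume "C = prod_emb UNIV (\<lambda>_. unit_interval) J (Pi\<^sub>E J X)"
    and J: "finite J" "\<And>j. j \<in> J \<Longrightarrow> X j \<in> sets unit_interval"
  then have "C = cylinder J X"
    by (auto simp: cylinder_def prod_emb_def PiE_def Pi_def extensional_def)
  then show thesis using J by (intro that) auto
qed

lemma distr_reindex_noise:
  assumes "inj \<pi>"
  shows "distr noise noise (\<lambda>\<omega>. \<omega> \<circ> \<pi>) = noise"
  using distr_PiM_reindex[of UNIV "\<lambda>_. unit_interval" \<pi> UNIV] assms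
  by (simp add: noise_def prob_space_unit_interval comp_def restrict_def)

lemma measurable_reindex_noise [measurable]: "(\<lambda>\<omega>. \<omega> \<circ> \<pi>) \<in> noise \<rightarrow>\<^sub>M noise"
  unfolding noise_def comp_def by (rule measurable_PiM_single') auto

lemma measure_reindex_noise:
  assumes "inj \<pi>" "A \<in> sets noise"
  shows "measure noise ((\<lambda>\<omega>. \<omega> \<circ> \<pi>) -` A \<inter> space noise) = measure noise A"
  using measure_distr[OF measurable_reindex_noise assms(2), of \<pi>] distr_reindex_noise[OF assms(1)]
  by simp

text \<open>
  Cylinders over disjoint finite index sets are independent, so for cylinders the sequence is
  eventually equal to its limit.
\<close>
lemma mixing_reindex_noise:
  fixes \<pi> :: "nat \<Rightarrow> nat \<Rightarrow> nat"
  assumes inj: "\<And>n. inj (\<pi> n)"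
    and escape: "\<And>J K. finite J \<Longrightarrow> finite K \<Longrightarrow> \<forall>\<^sub>F n in sequentially. J \<inter> \<pi> n ` K = {}"
    and "A \<in> sets noise" "B \<in> sets noise"
  shows "(\<lambda>n. measure noise (A \<inter> ((\<lambda>\<omega>. \<omega> \<circ> \<pi> n) -` B \<inter> space noise)))
    \<longlonglongrightarrow> measure noise A * measure noise B"
proof (rule noise.mixing_of_generator[OF cylinder_generator Int_stable_prod_algebra
      measurable_reindex_noise measure_reindex_noise[OF inj] _ assms(3,4)])
  fix A B :: "(nat \<Rightarrow> real) set"
  assume gen: "A \<in> prod_algebra UNIV (\<lambda>_. unit_interval)" "B \<in> prod_algebra UNIV (\<lambda>_. unit_interval)"
  obtain J X where A: "A = cylinder J X" "finite J" "\<And>j. j \<in> J \<Longrightarrow> X j \<in> sets borel"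
    by (rule generator_is_cylinder[OF gen(1)]) (rule that)
  obtain K Y where B: "B = cylinder K Y" "finite K" "\<And>j. j \<in> K \<Longrightarrow> Y j \<in> sets borel"
    by (rule generator_is_cylinder[OF gen(2)]) (rule that)
  have "measure noise (A \<inter> ((\<lambda>\<omega>. \<omega> \<circ> \<pi> n) -` B \<inter> space noise)) = measure noise A * measure noise B"
    if disj: "J \<inter> \<pi> n ` K = {}" for n
  proof -
    \<comment> \<open>The preimage of \<open>B\<close> is the cylinder over \<open>\<pi> n ` K\<close> with the sets \<open>?Y\<close>.\<close>
    let ?Y = "\<lambda>k. Y (inv (\<pi> n) k)"
    let ?Z = "\<lambda>k. if k \<in> J then X k else ?Y k"
    have inv: "inv (\<pi> n) (\<pi> n k) = k" for k by (rule inv_f_f[OF inj])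
    have notJ: "\<pi> n k \<notin> J" if "k \<in> K" for k using disj that by auto
    have "A \<inter> ((\<lambda>\<omega>. \<omega> \<circ> \<pi> n) -` B \<inter> space noise) = cylinder (J \<union> \<pi> n ` K) ?Z"
      unfolding A(1) B(1) cylinder_def using notJ by (auto simp: ball_Un inv)
    also have "measure noise \<dots> = (\<Prod>j\<in>J \<union> \<pi> n ` K. measure unit_interval (?Z j))"
      using A(2,3) B(2,3) by (intro measure_cylinder) (auto simp: inv)
    also have "\<dots> = (\<Prod>j\<in>J. measure unit_interval (?Z j)) * (\<Prod>j\<in>\<pi> n ` K. measure unit_interval (?Z j))"
      using A(2) B(2) disj by (intro prod.union_disjoint) auto
    also have "(\<Prod>j\<in>J. measure unit_interval (?Z j)) = measure noise A"
      using A by (simp add: measure_cylinder)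
    also have "(\<Prod>j\<in>\<pi> n ` K. measure unit_interval (?Z j)) = measure noise B"
      using B inj_on_subset[OF inj] notJ
      by (simp add: measure_cylinder prod.reindex inv cong: prod.cong)
    finally show ?thesis .
  qed
  then show "(\<lambda>n. measure noise (A \<inter> ((\<lambda>\<omega>. \<omega> \<circ> \<pi> n) -` B \<inter> space noise)))
      \<longlonglongrightarrow> measure noise A * measure noise B"
    by (intro tendsto_eventually eventually_mono[OF escape[OF A(2) B(2)]])
qed

section \<open>A commuting ergodic pair of shifts\<close>

text \<open>
  The bijection \<open>int \<times> nat \<rightarrow> nat\<close> which arranges the coordinates in countably many two-sided
  sequences: \<open>site i j\<close> is time \<open>i\<close> in track \<open>j\<close>.
\<close>
definition site :: "int \<Rightarrow> nat \<Rightarrow> nat" where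
  "site i j = prod_encode (int_encode i, j)"

lemma site_eq_iff [simp]: "site i j = site i' j' \<longleftrightarrow> i = i' \<and> j = j'"
  by (simp add: site_def int_encode_eq)

lemma site_cases: obtains i j where "k = site i j"
  by (metis int_decode_inverse prod.collapse prod_decode_inverse site_def)

definition move :: "(nat \<Rightarrow> int) \<Rightarrow> nat \<Rightarrow> nat" where
  "move v k = (case prod_decode k of (a, j) \<Rightarrow> site (int_decode a + v j) j)"

lemma move_site [simp]: "move v (site i j) = site (i + v j) j"
  by (simp add: move_def site_def)

lemma move_move: "move v (move w k) = move (\<lambda>j. v j + w j) k"
  by (cases k rule: site_cases) (simp add: add.commute add.left_commute)

lemma move_zero: "move (\<lambda>j. 0) k = k"
  by (cases k rule: site_cases) simp

lemma inj_move: "inj (move v)"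
  by (rule inj_on_inverseI[of _ "move (\<lambda>j. - v j)"]) (simp add: move_move move_zero)

definition shift :: "(nat \<Rightarrow> int) \<Rightarrow> (nat \<Rightarrow> real) \<Rightarrow> nat \<Rightarrow> real" where
  "shift v \<omega> = \<omega> \<circ> move v"

lemma shift_site [simp]: "shift v \<omega> (site i j) = \<omega> (site (i + v j) j)"
  by (simp add: shift_def)

lemma shift_shift: "shift v (shift w \<omega>) = shift (\<lambda>j. v j + w j) \<omega>"
  by (simp add: shift_def fun_eq_iff move_move add.commute)

lemma shift_zero: "shift (\<lambda>j. 0) = id"
  by (simp add: shift_def fun_eq_iff move_zero)

lemma shift_uminus: "shift (\<lambda>j. - v j) (shift v \<omega>) = \<omega>" "shift v (shift (\<lambda>j. - v j) \<omega>) = \<omega>"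
  by (simp_all add: shift_shift shift_zero)

lemma bij_shift: "bij (shift v)"
  by (rule o_bij[of "shift (\<lambda>j. - v j)"]) (simp_all add: fun_eq_iff shift_uminus)

lemma inv_shift: "inv (shift v) = shift (\<lambda>j. - v j)"
  by (rule inv_equality) (simp_all add: shift_uminus)

lemma funpow_shift: "shift v ^^ n = shift (\<lambda>j. int n * v j)"
proof (induction n)
  case (Suc n)
  have "(shift v ^^ Suc n) \<omega> = shift (\<lambda>j. v j + int n * v j) \<omega>" for \<omega>
    by (simp add: Suc.IH shift_shift)
  then show ?case by (simp add: fun_eq_iff algebra_simps)
qed (simp add: shift_zero)

lemma int_iterate_shift: "int_iterate noise (shift v) n = shift (\<lambda>j. n * v j)"
  by (simp add: int_iterate_def inv_shift funpow_shift)

lemma measure_preserving_system_shift: "measure_preserving_system noise [shift v, shift w]"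
proof
  fix T assume "T \<in> set [shift v, shift w]"
  then obtain u where T: "T = shift u" by auto
  show "bij_betw T (space noise) (space noise)" by (simp add: T bij_shift)
  have "shift u \<in> noise \<rightarrow>\<^sub>M noise" for u
    unfolding shift_def[abs_def] by (rule measurable_reindex_noise)
  then show "T \<in> noise \<rightarrow>\<^sub>M noise" "inv_into (space noise) T \<in> noise \<rightarrow>\<^sub>M noise"
    by (simp_all add: T inv_shift)
  show "measure noise (T -` A \<inter> space noise) = measure noise A" if "A \<in> sets noise" for A
    using measure_reindex_noise[OF inj_move that] by (simp add: T shift_def[abs_def])
qed

text \<open>
  If every track moves forward, then each site runs away from any given site, so a finite set of sites
  is eventually disjoint from any other.
\<close>
lemma mixing_shift:
  assumes u: "\<And>j. 0 < u j" and A: "A \<in> sets noise" "B \<in> sets noise"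
  shows "(\<lambda>n. measure noise (A \<inter> (shift (\<lambda>j. int n * u j) -` B \<inter> space noise)))
    \<longlonglongrightarrow> measure noise A * measure noise B"
  unfolding shift_def[abs_def]
proof (rule mixing_reindex_noise[OF inj_move _ A])
  fix J K :: "nat set"
  assume "finite J" "finite K"
  have "\<forall>\<^sub>F n in sequentially. a \<noteq> move (\<lambda>j. int n * u j) b" for a b
  proof -
    obtain i j where a: "a = site i j" by (rule site_cases)
    obtain i' j' where b: "b = site i' j'" by (rule site_cases)
    have "i \<noteq> i' + int n * u j" if "n > nat (i - i')" for n
    proof
      assume "i = i' + int n * u j"
      moreover have "int n * 1 \<le> int n * u j" using u[of j] by (intro mult_left_mono) auto
      ultimately show False using that by linarith
    qed
    then show ?thesis
      by (intro eventually_mono[OF eventually_gt_at_top[of "nat (i - i')"]]) (auto simp: a b)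
  qed
  then have "\<forall>\<^sub>F n in sequentially. \<forall>a\<in>J. \<forall>b\<in>K. a \<noteq> move (\<lambda>j. int n * u j) b"
    using \<open>finite J\<close> \<open>finite K\<close> by (intro eventually_ball_finite ballI) auto
  then show "\<forall>\<^sub>F n in sequentially. J \<inter> move (\<lambda>j. int n * u j) ` K = {}"
    by eventually_elim auto
qed

text \<open>
  A set invariant under both shifts is invariant under their composition, which is mixing by the
  assumption. So its measure equals its own square.
\<close>
lemma ergodic_system_shift:
  assumes pos: "\<And>j. 0 < v j + w j"
  shows "ergodic_system noise [shift v, shift w]"
proof -
  interpret measure_preserving_system noise "[shift v, shift w]"
    by (rule measure_preserving_system_shift)
  show ?thesis
  proof
    fix A assume A: "A \<in> sets noise"
      and inv: "\<And>T. T \<in> set [shift v, shift w] \<Longrightarrow> T -` A \<inter> space noise = A"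
    have "shift v -` A = A" "shift w -` A = A" using inv[of "shift v"] inv[of "shift w"] by auto
    then have vw: "shift v \<omega> \<in> A \<longleftrightarrow> \<omega> \<in> A" "shift w \<omega> \<in> A \<longleftrightarrow> \<omega> \<in> A" for \<omega> by blast+
    let ?u = "\<lambda>j. v j + w j"
    have "shift ?u \<omega> \<in> A \<longleftrightarrow> \<omega> \<in> A" for \<omega> by (simp add: vw flip: shift_shift)
    then have "(shift ?u ^^ n) \<omega> \<in> A \<longleftrightarrow> \<omega> \<in> A" for n \<omega> by (induction n) auto
    then have "shift (\<lambda>j. int n * ?u j) -` A = A" for n by (auto simp: funpow_shift)
    then have "(\<lambda>n::nat. measure noise A) \<longlonglongrightarrow> measure noise A * measure noise A"
      using mixing_shift[of ?u A A] pos A by simp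
    then have "measure noise A = measure noise A * measure noise A"
      by (simp add: LIMSEQ_const_iff)
    then show "measure noise A = 0 \<or> measure noise A = 1" by simp
  qed
qed

section \<open>Events defined by finitely many labels\<close>

text \<open>
  For \<open>N > 0\<close> this is the interval \<open>[c / N, (c + 1) / N)\<close>: a uniform random real carries each of the
  labels \<open>0, ..., N - 1\<close> with the same probability.
\<close>
definition cell :: "nat \<Rightarrow> nat \<Rightarrow> real set" where
  "cell N c = {x. \<lfloor>real N * x\<rfloor> = int c}"

lemma cell_sets [measurable]: "cell N c \<in> sets borel"
  unfolding cell_def by measurable

lemma measure_cell:
  assumes "c < N"
  shows "measure unit_interval (cell N c) = 1 / real N"
proof -
  have "0 \<le> real c / real N" "(real c + 1) / real N \<le> 1" using assms by (auto simp: divide_le_eq)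
  moreover have "cell N c = {real c / real N ..< (real c + 1) / real N}"
    using assms by (auto simp: cell_def floor_eq_iff field_simps)
  ultimately have "{0..<1} \<inter> cell N c = {real c / real N ..< (real c + 1) / real N}" by auto
  moreover have "(real c + 1) / real N - real c / real N = 1 / real N"
    by (simp flip: diff_divide_distrib)
  ultimately show ?thesis
    by (simp add: unit_interval_def measure_uniform_measure divide_right_mono)
qed

lemma cell_unique: "x \<in> cell N a \<Longrightarrow> x \<in> cell N b \<Longrightarrow> a = b"
  by (simp add: cell_def)

definition pattern :: "nat \<Rightarrow> (nat \<times> nat) list \<Rightarrow> (nat \<Rightarrow> real) set" where
  "pattern N xs = {\<omega>. \<forall>(k, c) \<in> set xs. \<omega> k \<in> cell N c}"

lemma
  assumes "distinct (map fst xs)"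
  shows pattern_sets: "pattern N xs \<in> sets noise"
    and measure_pattern: "(\<And>k c. (k, c) \<in> set xs \<Longrightarrow> c < N) \<Longrightarrow>
      measure noise (pattern N xs) = 1 / real N ^ length xs"
proof -
  let ?X = "\<lambda>k. cell N (the (map_of xs k))"
  have the: "the (map_of xs k) = c" if "(k, c) \<in> set xs" for k c
    using assms that by simp
  have eq: "pattern N xs = cylinder (fst ` set xs) ?X"
    by (auto simp: pattern_def cylinder_def the)
  show "pattern N xs \<in> sets noise" unfolding eq by (rule cylinder_sets) auto
  assume less: "\<And>k c. (k, c) \<in> set xs \<Longrightarrow> c < N"
  have "measure noise (pattern N xs) = (\<Prod>k\<in>fst ` set xs. measure unit_interval (?X k))"
    unfolding eq by (rule measure_cylinder) auto
  also have "\<dots> = (\<Prod>k\<in>fst ` set xs. 1 / real N)"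
    by (intro prod.cong refl measure_cell) (auto simp: the dest: less)
  also have "card (fst ` set xs) = length xs"
    using assms distinct_card[of "map fst xs"] by simp
  then have "(\<Prod>k\<in>fst ` set xs. 1 / real N) = 1 / real N ^ length xs"
    by (simp add: power_one_over)
  finally show "measure noise (pattern N xs) = 1 / real N ^ length xs" .
qed

section \<open>Returns of an event given by label triples\<close>

text \<open>
  Tracks 0 and 1 are each fixed by one of the two shifts. Track 2 is moved by both at the same speed,
  so that the two shifted triples share its site at time \<open>n\<close>. The tracks from 3 on have to
  move as well, since a fixed track would destroy ergodicity.
\<close>
definition velocity1 :: "nat \<Rightarrow> int" where "velocity1 j = (if j = 1 then 0 else 1)"
definition velocity2 :: "nat \<Rightarrow> int" where "velocity2 j = (if j = 0 then 0 else 1)"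

definition corner_event ::
  "nat \<Rightarrow> 'p set \<Rightarrow> ('p \<Rightarrow> nat) \<Rightarrow> ('p \<Rightarrow> nat) \<Rightarrow> ('p \<Rightarrow> nat) \<Rightarrow> (nat \<Rightarrow> real) set" where
  "corner_event N P \<alpha> \<beta> \<gamma> =
    (\<Union>p\<in>P. pattern N [(site 0 0, \<alpha> p), (site 0 1, \<beta> p), (site 0 2, \<gamma> p)])"

context
  fixes N :: nat and P :: "'p set" and \<alpha> \<beta> \<gamma> :: "'p \<Rightarrow> nat"
  assumes finite: "finite P"
    and labels: "\<And>p. p \<in> P \<Longrightarrow> \<alpha> p < N \<and> \<beta> p < N \<and> \<gamma> p < N"
    and triangle_unique: "\<And>p q r. \<lbrakk>p \<in> P; q \<in> P; r \<in> P; \<beta> p = \<beta> q; \<alpha> p = \<alpha> r; \<gamma> q = \<gamma> r\<rbrakk>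
      \<Longrightarrow> q = p \<and> r = p"
begin

lemma corner_event_sets: "corner_event N P \<alpha> \<beta> \<gamma> \<in> sets noise"
  unfolding corner_event_def by (intro sets.finite_UN finite pattern_sets) auto

text \<open>
  The hypothesis on triangles, applied to \<open>p, q, q\<close>, says that different elements of \<open>P\<close> have different
  label triples. Thus the event is a disjoint union of \<open>|P|\<close> patterns on three sites.
\<close>
lemma measure_corner_event: "measure noise (corner_event N P \<alpha> \<beta> \<gamma>) = real (card P) / real N ^ 3"
proof -
  let ?X = "\<lambda>p. pattern N [(site 0 0, \<alpha> p), (site 0 1, \<beta> p), (site 0 2, \<gamma> p)]"
  have "disjoint_family_on ?X P"
  proof (unfold disjoint_family_on_def, intro ballI impI equals0I)
    fix p q \<omega> assume "p \<in> P" "q \<in> P" "p \<noteq> q" "\<omega> \<in> ?X p \<inter> ?X q"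
    moreover from this have "\<alpha> p = \<alpha> q" "\<beta> p = \<beta> q" "\<gamma> p = \<gamma> q"
      by (auto simp: pattern_def intro: cell_unique)
    ultimately show False using triangle_unique[of p q q] by simp
  qed
  then have "measure noise (corner_event N P \<alpha> \<beta> \<gamma>) = (\<Sum>p\<in>P. measure noise (?X p))"
    unfolding corner_event_def
    by (intro noise.finite_measure_finite_Union finite) (auto intro: pattern_sets)
  also have "\<dots> = (\<Sum>p\<in>P. 1 / real N ^ 3)"
    using labels by (intro sum.cong refl) (subst measure_pattern, auto simp: numeral_3_eq_3)
  finally show ?thesis by simp
qed

text \<open>
  The original triple and the one shifted by \<open>n\<close> under the first map share the site in track 1, the
  original and the one shifted under the second map share the site in track 0, and the two shifted ones
  share the site in track 2. So the three elements of \<open>P\<close> responsible for the returns coincide, and one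
  element of \<open>P\<close> determines the labels of all six sites.
\<close>
lemma measure_corner_event_return:
  assumes "n \<noteq> 0"
  shows "measure noise (corner_event N P \<alpha> \<beta> \<gamma>
      \<inter> preimage_iterate noise (shift velocity1) n (corner_event N P \<alpha> \<beta> \<gamma>)
      \<inter> preimage_iterate noise (shift velocity2) n (corner_event N P \<alpha> \<beta> \<gamma>))
    \<le> real (card P) / real N ^ 6" (is "measure noise ?R \<le> _")
proof -
  let ?Y = "\<lambda>p. pattern N [(site 0 0, \<alpha> p), (site 0 1, \<beta> p), (site 0 2, \<gamma> p),
    (site n 0, \<alpha> p), (site n 1, \<beta> p), (site n 2, \<gamma> p)]"
  have "?R \<subseteq> (\<Union>p\<in>P. ?Y p)"
  proof
    fix \<omega> assume "\<omega> \<in> ?R"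
    then obtain p q r where pqr: "p \<in> P" "q \<in> P" "r \<in> P"
      and p: "\<omega> (site 0 0) \<in> cell N (\<alpha> p)" "\<omega> (site 0 1) \<in> cell N (\<beta> p)" "\<omega> (site 0 2) \<in> cell N (\<gamma> p)"
      and q: "\<omega> (site n 0) \<in> cell N (\<alpha> q)" "\<omega> (site 0 1) \<in> cell N (\<beta> q)" "\<omega> (site n 2) \<in> cell N (\<gamma> q)"
      and r: "\<omega> (site 0 0) \<in> cell N (\<alpha> r)" "\<omega> (site n 1) \<in> cell N (\<beta> r)" "\<omega> (site n 2) \<in> cell N (\<gamma> r)"
      by (auto simp: preimage_iterate_def int_iterate_shift corner_event_def pattern_def
          velocity1_def velocity2_def)
    have "q = p \<and> r = p"
      using pqr cell_unique p q r by (intro triangle_unique) blast+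
    then show "\<omega> \<in> (\<Union>p\<in>P. ?Y p)" using pqr p q r by (auto simp: pattern_def)
  qed
  then have "measure noise ?R \<le> measure noise (\<Union>p\<in>P. ?Y p)"
    using assms by (intro noise.finite_measure_mono sets.finite_UN finite pattern_sets) auto
  also have "\<dots> \<le> (\<Sum>p\<in>P. measure noise (?Y p))"
    using assms by (intro noise.finite_measure_subadditive_finite finite) (auto intro!: pattern_sets)
  also have "\<dots> = (\<Sum>p\<in>P. 1 / real N ^ 6)"
    using labels assms by (intro sum.cong refl) (subst measure_pattern, auto simp: eval_nat_numeral)
  finally show ?thesis by simp
qed

end

theorem theorem1p2:
  shows "\<exists>(M :: (nat \<Rightarrow> real) measure) T\<^sub>1 T\<^sub>2.
    measure_preserving_system M [T\<^sub>1, T\<^sub>2] \<and>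
    (\<forall>x\<in>space M. T\<^sub>1 (T\<^sub>2 x) = T\<^sub>2 (T\<^sub>1 x)) \<and>
    ergodic_system M [T\<^sub>1, T\<^sub>2] \<and>
    (\<forall>l::real. 0 < l \<and> l < 4 \<longrightarrow>
      (\<exists>A\<in>sets M. \<forall>n::int. n \<noteq> 0 \<longrightarrow>
        measure M (A \<inter> preimage_iterate M T\<^sub>1 n A \<inter> preimage_iterate M T\<^sub>2 n A)
          < measure M A powr l))"
proof (intro exI conjI allI impI ballI)
  show "measure_preserving_system noise [shift velocity1, shift velocity2]"
    by (rule measure_preserving_system_shift)
  show "shift velocity1 (shift velocity2 \<omega>) = shift velocity2 (shift velocity1 \<omega>)" for \<omega>
    by (simp add: shift_shift add.commute)
  show "ergodic_system noise [shift velocity1, shift velocity2]"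
    by (rule ergodic_system_shift) (simp add: velocity1_def velocity2_def)
  fix l :: real
  assume l: "0 < l \<and> l < 4"
  obtain m d :: nat where md: "m \<ge> 1" "d \<ge> 1"
    and bound: "\<And>c. \<lbrakk>c \<le> m ^ (2 * d); m ^ (2 * d) \<le> c * (2 * d * m\<^sup>2)\<rbrakk>
      \<Longrightarrow> real c / real ((2 * m) ^ d) ^ 6 < (real c / real ((2 * m) ^ d) ^ 3) powr l"
    using triangle_system_parameters[of l] l by blast
  let ?N = "(2 * m) ^ d"
  obtain P :: "((nat \<Rightarrow> int) \<times> (nat \<Rightarrow> int)) set" and \<alpha> \<beta> \<gamma> :: "_ \<Rightarrow> nat"
    where P: "finite P" "card P \<le> m ^ (2 * d)" "m ^ (2 * d) \<le> card P * (2 * d * m\<^sup>2)"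
      "\<And>p. p \<in> P \<Longrightarrow> \<alpha> p < ?N \<and> \<beta> p < ?N \<and> \<gamma> p < ?N"
      "\<And>p q r. \<lbrakk>p \<in> P; q \<in> P; r \<in> P; \<beta> p = \<beta> q; \<alpha> p = \<alpha> r; \<gamma> q = \<gamma> r\<rbrakk> \<Longrightarrow> q = p \<and> r = p"
    by (rule triangle_system_exists[OF md]) (rule that)
  note event = P(1) P(4) P(5)
  let ?A = "corner_event ?N P \<alpha> \<beta> \<gamma>"
  show "\<exists>A\<in>sets noise. \<forall>n::int. n \<noteq> 0 \<longrightarrow>
      measure noise (A \<inter> preimage_iterate noise (shift velocity1) n A
        \<inter> preimage_iterate noise (shift velocity2) n A) < measure noise A powr l"
  proof (intro bexI[of _ ?A] allI impI)
    show "?A \<in> sets noise" using event by (rule corner_event_sets)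
    fix n :: int
    assume "n \<noteq> 0"
    have "measure noise (?A \<inter> preimage_iterate noise (shift velocity1) n ?A
        \<inter> preimage_iterate noise (shift velocity2) n ?A) \<le> real (card P) / real ?N ^ 6"
      using event \<open>n \<noteq> 0\<close> by (rule measure_corner_event_return)
    also have "\<dots> < (real (card P) / real ?N ^ 3) powr l" by (rule bound[OF P(2,3)])
    also have "real (card P) / real ?N ^ 3 = measure noise ?A"
      using event by (rule measure_corner_event[symmetric])
    finally show "measure noise (?A \<inter> preimage_iterate noise (shift velocity1) n ?A
        \<inter> preimage_iterate noise (shift velocity2) n ?A) < measure noise ?A powr l" .
  qed
qed

end
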